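(* No element of $\mathbb{Z}(X)$ is simultaneously a sum-type expression of positive depth and a product-type expression of positive depth; i.e., a sum-type expression of positive depth and a product-type expression of positive depth can never be equal.
   Context: Let $X = \{x_1, x_2, \ldots\}$ be a countably infinite set of formal variables, $\mathbb{Z}[X]$ the integer polynomial ring and $\mathbb{Z}(X)$ its field of fractions. For $f \in \mathbb{Z}(X)$ with canonical representation $f = \frac{P}{Q}$ ($P,Q$ coprime, $Q \ne 0$), $\operatorname{Var}(f)$ is the set of variables $x_i$ that occur with positive exponent in some monomial with nonzero coefficient of $P$ or of $Q$. Sum-type and product-type expressions of depth $0$ are the elements $x_i$ and $-x_i$, $i \in \mathbb{N}$. For $k \in \mathbb{N}$: a sum-type expression of depth $k$ is an $f \in \mathbb{Z}(X)$ that can be written as $f = \sum_{i=1}^s f_i$ with $s \ge 2$, where the nonzero $f_1,\dots,f_s$ are all product-type expressions of depth at most $k-1$, at least one of depth exactly $k-1$, and $\operatorname{Var}(f_1),\dots,\operatorname{Var}(f_s)$ are mutually disjoint. A product-type expression of depth $k$ is an $f \in \mathbb{Z}(X)$ that can be written as $f = \frac{\prod_{i=1}^s f_i}{\prod_{i=1}^t g_i}$ with $s \ge 1$, $t \ge 0$, $s+t \ge 2$, where the nonzero $f_1,\dots,f_s,g_1,\dots,g_t$ are all sum-type expressions of depth at most $k-1$, at least one of depth exactly $k-1$, and $\operatorname{Var}(f_1),\dots,\operatorname{Var}(f_s),\operatorname{Var}(g_1),\dots,\operatorname{Var}(g_t)$ are mutually disjoint. *)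

theory Defs
  imports
    "HOL-Library.Poly_Mapping"
    "HOL-Computational_Algebra.Fraction_Field"
begin

text \<open>
  A polynomial maps each monomial to its integer coefficient, and a monomial maps (the index of)
  each variable to its exponent, both with finite support. The natural numbers, including 0,
  index the countably many variables.
\<close>

type_synonym int_mpoly = "(nat \<Rightarrow>\<^sub>0 nat) \<Rightarrow>\<^sub>0 int"
type_synonym int_ratfun = "int_mpoly fract"

definition X :: "nat \<Rightarrow> int_ratfun" where
  "X i = Fract (Poly_Mapping.single (Poly_Mapping.single i 1) 1) 1"

definition poly_vars :: "int_mpoly \<Rightarrow> nat set" where
  "poly_vars p = (\<Union>m\<in>Poly_Mapping.keys p. Poly_Mapping.keys m)"

text \<open>
  The library constant \<^const>\<open>coprime\<close> requires a ring with a division operation, which is not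
  available here; this is the same condition stated for the polynomial ring.
\<close>

definition coprime_poly :: "int_mpoly \<Rightarrow> int_mpoly \<Rightarrow> bool" where
  "coprime_poly P Q \<longleftrightarrow> (\<forall>c. c dvd P \<longrightarrow> c dvd Q \<longrightarrow> c dvd 1)"

text \<open>
  The coprime representation of a rational function is unique up to a common sign, which does not
  affect the occurring variables; so it does not matter that all such representations are
  collected here.
\<close>

definition Var :: "int_ratfun \<Rightarrow> nat set" where
  "Var f = {i. \<exists>P Q. Q \<noteq> 0 \<and> coprime_poly P Q \<and> f = Fract P Q \<and> i \<in> poly_vars P \<union> poly_vars Q}"

text \<open>
  Disjointness is required for any two different positions of the list, so an entry that is
  repeated must have no variables.
\<close>

definition disjoint_Vars :: "int_ratfun list \<Rightarrow> bool" where
  "disjoint_Vars fs \<longleftrightarrow>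
     (\<forall>i<length fs. \<forall>j<length fs. i \<noteq> j \<longrightarrow> Var (fs ! i) \<inter> Var (fs ! j) = {})"

text \<open>
  \<open>sum_type k f\<close> says that \<open>f\<close> is a sum-type expression of depth \<open>k\<close>. It is a relation, so nothing
  is presupposed about the uniqueness of the depth; being of depth at most \<open>k\<close> means being of
  depth \<open>j\<close> for some \<open>j \<le> k\<close>.
\<close>

inductive sum_type :: "nat \<Rightarrow> int_ratfun \<Rightarrow> bool"
  and prod_type :: "nat \<Rightarrow> int_ratfun \<Rightarrow> bool" where
  sum_type_var: "sum_type 0 (X i)"
| sum_type_neg_var: "sum_type 0 (- X i)"
| prod_type_var: "prod_type 0 (X i)"
| prod_type_neg_var: "prod_type 0 (- X i)"
| sum_type_Suc:
    "\<lbrakk> length fs \<ge> 2;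
       \<forall>f\<in>set fs. f \<noteq> 0 \<and> (\<exists>j\<le>k. prod_type j f);
       \<exists>f\<in>set fs. prod_type k f;
       disjoint_Vars fs \<rbrakk>
     \<Longrightarrow> sum_type (Suc k) (sum_list fs)"
| prod_type_Suc:
    "\<lbrakk> length fs \<ge> 1; length fs + length gs \<ge> 2;
       \<forall>f\<in>set (fs @ gs). f \<noteq> 0 \<and> (\<exists>j\<le>k. sum_type j f);
       \<exists>f\<in>set (fs @ gs). sum_type k f;
       disjoint_Vars (fs @ gs) \<rbrakk>
     \<Longrightarrow> prod_type (Suc k) (prod_list fs / prod_list gs)"

end

theory Submission
  imports Defs
begin

text \<open>
  Let \<open>D\<^sub>i\<close> be the derivation \<open>x\<^sub>i \<partial>/\<partial>x\<^sub>i\<close> of the field of rational functions. If \<open>D\<^sub>i f \<noteq> 0\<close>, then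
  \<open>x\<^sub>i\<close> occurs in \<open>f\<close>; hence it suffices to show that no \<open>f\<close> can be written both as \<open>a + b\<close> and as
  \<open>c d\<close> where \<open>a\<close>, \<open>b\<close> (and likewise \<open>c\<close>, \<open>d\<close>) are not annihilated by all \<open>D\<^sub>i\<close>, but every \<open>D\<^sub>i\<close>
  annihilates one of them. The first representation gives \<open>D\<^sub>j D\<^sub>i f = 0\<close> whenever \<open>D\<^sub>i a \<noteq> 0\<close> and
  \<open>D\<^sub>j b \<noteq> 0\<close>. If in addition \<open>D\<^sub>i c \<noteq> 0\<close> and \<open>D\<^sub>j d \<noteq> 0\<close>, then the second one gives
  \<open>D\<^sub>j D\<^sub>i f = D\<^sub>i c D\<^sub>j d \<noteq> 0\<close>. So two partitions of the same set into two nonempty parts would have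
  no crossing pairs of indices, which is impossible.
\<close>

section \<open>Derivations\<close>

locale derivation =
  fixes d :: "'a::comm_ring_1 \<Rightarrow> 'a"
  assumes add: "d (x + y) = d x + d y"
    and mult: "d (x * y) = d x * y + x * d y"
begin

lemma zero [simp]: "d 0 = 0"
  using add[of 0 0] by simp

lemma one [simp]: "d 1 = 0"
  using mult[of 1 1] by simp

lemma uminus: "d (- x) = - d x"
  using add[of x "- x"] by (simp add: eq_neg_iff_add_eq_0 add.commute)

end

definition fract_deriv :: "('a::idom \<Rightarrow> 'a) \<Rightarrow> 'a fract \<Rightarrow> 'a fract" where
  "fract_deriv d f =
     (THE g. \<forall>P Q. Q \<noteq> 0 \<longrightarrow> f = Fract P Q \<longrightarrow> g = Fract (d P * Q - P * d Q) (Q * Q))"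

context
  fixes d :: "'a::idom \<Rightarrow> 'a"
  assumes d: "derivation d"
begin

interpretation derivation d by (rule d)

lemma fract_deriv_Fract:
  assumes "Q \<noteq> 0"
  shows "fract_deriv d (Fract P Q) = Fract (d P * Q - P * d Q) (Q * Q)"
  unfolding fract_deriv_def
proof (rule the_equality)
  have "Fract (d P * Q - P * d Q) (Q * Q) = Fract (d R * S - R * d S) (S * S)"
    if S: "S \<noteq> 0" and eq: "Fract P Q = Fract R S" for R S
  proof -
    have eq': "P * S = R * Q"
      using assms S eq by (simp add: eq_fract)
    hence "d P * S + P * d S = d R * Q + R * d Q"
      using mult by metis
    hence "(d P * Q - P * d Q) * (S * S) = (d R * S - R * d S) * (Q * Q)"
      using eq' by algebra
    thus ?thesis
      using assms S by (simp add: eq_fract)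
  qed
  thus "\<forall>R S. S \<noteq> 0 \<longrightarrow> Fract P Q = Fract R S \<longrightarrow>
      Fract (d P * Q - P * d Q) (Q * Q) = Fract (d R * S - R * d S) (S * S)"
    by blast
qed (use assms in blast)

lemma derivation_fract_deriv: "derivation (fract_deriv d)"
proof
  fix x y :: "'a fract"
  obtain P Q where x: "x = Fract P Q" "Q \<noteq> 0" by (cases x)
  obtain R S where y: "y = Fract R S" "S \<noteq> 0" by (cases y)
  show "fract_deriv d (x + y) = fract_deriv d x + fract_deriv d y"
    using x y by (simp add: fract_deriv_Fract eq_fract add mult algebra_simps)
  show "fract_deriv d (x * y) = fract_deriv d x * y + x * fract_deriv d y"
    using x y by (simp add: fract_deriv_Fract eq_fract add mult algebra_simps)
qed

end

lemma derivation_commutator: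
  assumes "derivation d" "derivation e"
  shows "derivation (\<lambda>x. d (e x) - e (d x))"
proof -
  interpret d: derivation d by fact
  interpret e: derivation e by fact
  show ?thesis
    by unfold_locales (simp_all add: d.add d.mult e.add e.mult algebra_simps)
qed

lemma fract_deriv_Fract_1:
  assumes "derivation d"
  shows "fract_deriv d (Fract P 1) = Fract (d P) 1"
  using assms by (simp add: fract_deriv_Fract derivation.one)

text \<open>The commutator is a derivation that vanishes on the ring, and hence on its fraction field.\<close>

lemma fract_deriv_commute:
  assumes d: "derivation d" and e: "derivation e" and comm: "\<And>x. d (e x) = e (d x)"
  shows "fract_deriv d (fract_deriv e f) = fract_deriv e (fract_deriv d f)"
proof (cases f)
  case (Fract P Q)
  define E where "E f = fract_deriv d (fract_deriv e f) - fract_deriv e (fract_deriv d f)" for f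
  have "derivation E"
    unfolding E_def by (intro derivation_commutator derivation_fract_deriv d e)
  moreover have "E (Fract R 1) = 0" for R
    using d e by (simp add: E_def fract_deriv_Fract_1 comm)
  moreover have "f * Fract Q 1 = Fract P 1"
    using Fract by (simp add: eq_fract)
  ultimately have "E f * Fract Q 1 = 0"
    using derivation.mult[of E f "Fract Q 1"] by simp
  moreover have "Fract Q 1 \<noteq> 0"
    using Fract by (simp add: Zero_fract_def eq_fract)
  ultimately show ?thesis
    by (simp add: E_def)
qed

locale commuting_derivations =
  fixes D :: "'i \<Rightarrow> 'k::field \<Rightarrow> 'k"
  assumes deriv: "derivation (D i)"
    and commute: "D i (D j f) = D j (D i f)"
begin

lemma D_zero [simp]: "D i 0 = 0" and D_one [simp]: "D i 1 = 0"
  and D_add: "D i (f + g) = D i f + D i g" and D_mult: "D i (f * g) = D i f * g + f * D i g"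
  by (simp_all add: derivation.zero[OF deriv] derivation.one[OF deriv]
      derivation.add[OF deriv] derivation.mult[OF deriv])

lemma D_inverse_eq_0_iff: "D i (inverse f) = 0 \<longleftrightarrow> D i f = 0"
proof (cases "f = 0")
  case False
  have "D i f * inverse f + f * D i (inverse f) = 0"
    using D_mult[of i f "inverse f"] False by simp
  thus ?thesis
    using False by auto
qed simp

definition supp :: "'k \<Rightarrow> 'i set" where
  "supp f = {i. D i f \<noteq> 0}"

lemma supp_inverse [simp]: "supp (inverse f) = supp f"
  by (simp add: supp_def D_inverse_eq_0_iff)

lemma supp_zero [simp]: "supp 0 = {}" and supp_one [simp]: "supp 1 = {}"
  by (simp_all add: supp_def)

lemma supp_add:
  assumes "supp f \<inter> supp g = {}"
  shows "supp (f + g) = supp f \<union> supp g"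
proof -
  have "D i (f + g) \<noteq> 0 \<longleftrightarrow> D i f \<noteq> 0 \<or> D i g \<noteq> 0" for i
  proof -
    have "D i f = 0 \<or> D i g = 0"
      using assms by (auto simp: supp_def)
    thus ?thesis
      by (elim disjE) (simp_all add: D_add)
  qed
  thus ?thesis
    by (auto simp: supp_def)
qed

lemma supp_mult:
  assumes "supp f \<inter> supp g = {}" "f \<noteq> 0" "g \<noteq> 0"
  shows "supp (f * g) = supp f \<union> supp g"
proof -
  have "D i (f * g) \<noteq> 0 \<longleftrightarrow> D i f \<noteq> 0 \<or> D i g \<noteq> 0" for i
  proof -
    have "D i f = 0 \<or> D i g = 0"
      using assms(1) by (auto simp: supp_def)
    thus ?thesis
      using assms(2,3) by (elim disjE) (simp_all add: D_mult)
  qed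
  thus ?thesis
    by (auto simp: supp_def)
qed

abbreviation disjoint_supps :: "'k list \<Rightarrow> bool" where
  "disjoint_supps \<equiv> sorted_wrt (\<lambda>f g. supp f \<inter> supp g = {})"

lemma supp_sum_list:
  "disjoint_supps fs \<Longrightarrow> supp (sum_list fs) = \<Union>(supp ` set fs)"
proof (induction fs)
  case (Cons f fs)
  moreover from this have "supp f \<inter> supp (sum_list fs) = {}"
    by auto
  ultimately show ?case
    by (simp add: supp_add)
qed simp

lemma supp_prod_list:
  "disjoint_supps fs \<Longrightarrow> 0 \<notin> set fs \<Longrightarrow> supp (prod_list fs) = \<Union>(supp ` set fs)"
proof (induction fs)
  case (Cons f fs)
  moreover from this have "supp f \<inter> supp (prod_list fs) = {}"
    by auto
  ultimately show ?case
    by (simp add: supp_mult prod_list_zero_iff)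
qed simp

lemma sum_ne_product:
  assumes ab: "supp a \<inter> supp b = {}" "supp a \<noteq> {}" "supp b \<noteq> {}"
    and cd: "supp c \<inter> supp d = {}" "supp c \<noteq> {}" "supp d \<noteq> {}"
  shows "a + b \<noteq> c * d"
proof
  assume eq: "a + b = c * d"
  have "c \<noteq> 0" "d \<noteq> 0"
    using cd by auto
  hence un: "supp a \<union> supp b = supp c \<union> supp d"
    using supp_add[OF ab(1)] supp_mult[OF cd(1)] eq by simp
  have mixed_sum: "D j (D i (a + b)) = 0" if "i \<in> supp a" "j \<in> supp b" for i j
  proof -
    have "D i b = 0" "D j a = 0"
      using ab(1) that by (auto simp: supp_def)
    thus ?thesis
      by (simp add: D_add commute[of j i a])
  qed
  have mixed_prod: "D j (D i (c * d)) \<noteq> 0" if "i \<in> supp c" "j \<in> supp d" for i j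
  proof -
    have "D i c \<noteq> 0" "D j d \<noteq> 0" "D i d = 0" "D j c = 0"
      using cd(1) that by (auto simp: supp_def)
    thus ?thesis
      by (simp add: D_mult commute[of j i c])
  qed
  have "i \<notin> supp a \<inter> supp c \<or> j \<notin> supp b \<inter> supp d" for i j
    using mixed_sum[of i j] mixed_prod[of i j] unfolding eq by blast
  hence "supp a \<inter> supp c = {} \<or> supp b \<inter> supp d = {}"
    by blast
  moreover have "i \<notin> supp b \<inter> supp c \<or> j \<notin> supp a \<inter> supp d" for i j
    using mixed_sum[of j i] mixed_prod[of i j] unfolding eq commute[of j i "c * d"] by blast
  hence "supp b \<inter> supp c = {} \<or> supp a \<inter> supp d = {}"
    by blast
  ultimately consider
      "supp a \<inter> supp c = {}" "supp b \<inter> supp c = {}"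
    | "supp a \<inter> supp c = {}" "supp a \<inter> supp d = {}"
    | "supp b \<inter> supp d = {}" "supp b \<inter> supp c = {}"
    | "supp b \<inter> supp d = {}" "supp a \<inter> supp d = {}"
    by blast
  moreover have "supp a \<subseteq> supp c \<union> supp d" "supp b \<subseteq> supp c \<union> supp d"
    "supp c \<subseteq> supp a \<union> supp b" "supp d \<subseteq> supp a \<union> supp b"
    using un by auto
  ultimately show False
    using ab(2,3) cd(2,3) by cases (blast)+
qed

lemma sum_list_ne_prod_list:
  assumes fs: "length fs \<ge> 2" "disjoint_supps fs" "{} \<notin> supp ` set fs"
    and gs: "length gs \<ge> 2" "disjoint_supps gs" "{} \<notin> supp ` set gs"
  shows "sum_list fs \<noteq> prod_list gs"
proof -
  obtain a a' as where a: "fs = a # a' # as"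
    using fs(1) by (cases fs; cases "tl fs") auto
  obtain c c' cs where c: "gs = c # c' # cs"
    using gs(1) by (cases gs; cases "tl gs") auto
  have "0 \<notin> set gs"
    using gs(3) by (force simp: image_iff)
  hence prod: "supp (prod_list (c' # cs)) = \<Union>(supp ` set (c' # cs))"
    using gs(2) by (intro supp_prod_list) (simp_all add: c)
  have sum: "supp (sum_list (a' # as)) = \<Union>(supp ` set (a' # as))"
    using fs(2) by (intro supp_sum_list) (simp add: a)
  have "a + sum_list (a' # as) \<noteq> c * prod_list (c' # cs)"
  proof (rule sum_ne_product)
    show "supp a \<inter> supp (sum_list (a' # as)) = {}"
      using fs(2) unfolding sum a by auto
    show "supp c \<inter> supp (prod_list (c' # cs)) = {}"
      using gs(2) unfolding prod c by auto
    show "supp a \<noteq> {}" "supp (sum_list (a' # as)) \<noteq> {}"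
      using fs(3) unfolding sum a by auto
    show "supp c \<noteq> {}" "supp (prod_list (c' # cs)) \<noteq> {}"
      using gs(3) unfolding prod c by auto
  qed
  thus ?thesis
    by (simp add: a c)
qed

end

section \<open>Derivations of the polynomial ring\<close>

lemma lookup_mult_keys:
  fixes p q :: "'a::monoid_add \<Rightarrow>\<^sub>0 'b::semiring_0"
  shows "Poly_Mapping.lookup (p * q) k =
    (\<Sum>(a, b)\<in>Poly_Mapping.keys p \<times> Poly_Mapping.keys q.
      Poly_Mapping.lookup p a * Poly_Mapping.lookup q b when k = a + b)"
proof -
  have "Poly_Mapping.lookup (p * q) k =
      (\<Sum>(a, b). Poly_Mapping.lookup p a * Poly_Mapping.lookup q b when k = a + b)"
    by (simp add: times_poly_mapping.rep_eq prod_fun_unfold_prod)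
  also have "\<dots> = (\<Sum>(a, b)\<in>Poly_Mapping.keys p \<times> Poly_Mapping.keys q.
      Poly_Mapping.lookup p a * Poly_Mapping.lookup q b when k = a + b)"
    by (rule Sum_any.expand_superset) (auto simp: in_keys_iff)
  finally show ?thesis .
qed

text \<open>
  The operator \<open>x\<^sub>i \<partial>/\<partial>x\<^sub>i\<close>. Unlike \<open>\<partial>/\<partial>x\<^sub>i\<close> it acts diagonally on monomials, so that the product rule
  can be checked one coefficient at a time.
\<close>

definition euler :: "nat \<Rightarrow> int_mpoly \<Rightarrow> int_mpoly" where
  "euler i p = Poly_Mapping.mapp (\<lambda>m c. int (Poly_Mapping.lookup m i) * c) p"

lemma lookup_euler:
  "Poly_Mapping.lookup (euler i p) m = int (Poly_Mapping.lookup m i) * Poly_Mapping.lookup p m"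
  by (auto simp: euler_def lookup_mapp when_def in_keys_iff)

lemma derivation_euler: "derivation (euler i)"
proof
  fix p q :: int_mpoly
  show "euler i (p + q) = euler i p + euler i q"
    by (rule poly_mapping_eqI) (simp add: lookup_euler lookup_add algebra_simps)
  show "euler i (p * q) = euler i p * q + p * euler i q"
  proof (rule poly_mapping_eqI)
    fix k
    have left: "Poly_Mapping.lookup (euler i p * q) k =
      (\<Sum>(a, b)\<in>Poly_Mapping.keys p \<times> Poly_Mapping.keys q.
        int (Poly_Mapping.lookup a i) * (Poly_Mapping.lookup p a * Poly_Mapping.lookup q b)
          when k = a + b)"
      unfolding lookup_mult_keys
      by (rule sum.mono_neutral_cong_left)
        (auto simp: lookup_euler in_keys_iff when_def split: if_splits)
    have right: "Poly_Mapping.lookup (p * euler i q) k =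
      (\<Sum>(a, b)\<in>Poly_Mapping.keys p \<times> Poly_Mapping.keys q.
        int (Poly_Mapping.lookup b i) * (Poly_Mapping.lookup p a * Poly_Mapping.lookup q b)
          when k = a + b)"
      unfolding lookup_mult_keys
      by (rule sum.mono_neutral_cong_left)
        (auto simp: lookup_euler in_keys_iff when_def split: if_splits)
    show "Poly_Mapping.lookup (euler i (p * q)) k =
        Poly_Mapping.lookup (euler i p * q + p * euler i q) k"
      unfolding lookup_euler lookup_add left right
      unfolding lookup_mult_keys sum_distrib_left sum.distrib[symmetric]
      by (rule sum.cong) (auto simp: when_def lookup_add algebra_simps)
  qed
qed

lemma euler_commute: "euler i (euler j p) = euler j (euler i p)"
  by (rule poly_mapping_eqI) (simp add: lookup_euler)

lemma euler_eq_0: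
  assumes "i \<notin> poly_vars p"
  shows "euler i p = 0"
  using assms
  by (intro poly_mapping_eqI) (auto simp: lookup_euler poly_vars_def in_keys_iff)

section \<open>Coprime representations\<close>

definition lead_monom :: "int_mpoly \<Rightarrow> nat \<Rightarrow>\<^sub>0 nat" where
  "lead_monom p = Max (Poly_Mapping.keys p)"

lemma lead_monom_in_keys: "p \<noteq> 0 \<Longrightarrow> lead_monom p \<in> Poly_Mapping.keys p"
  by (simp add: lead_monom_def)

lemma le_lead_monom: "m \<in> Poly_Mapping.keys p \<Longrightarrow> m \<le> lead_monom p"
  by (simp add: lead_monom_def)

lemma lookup_mult_lead_monom:
  assumes "p \<noteq> 0" "q \<noteq> 0"
  shows "Poly_Mapping.lookup (p * q) (lead_monom p + lead_monom q) =
    Poly_Mapping.lookup p (lead_monom p) * Poly_Mapping.lookup q (lead_monom q)"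
proof -
  have eq: "lead_monom p + lead_monom q = a + b \<longleftrightarrow> a = lead_monom p \<and> b = lead_monom q"
    if "a \<in> Poly_Mapping.keys p" "b \<in> Poly_Mapping.keys q" for a b
    using add_less_le_mono[of a "lead_monom p" b "lead_monom q"]
      add_le_less_mono[of a "lead_monom p" b "lead_monom q"]
      le_lead_monom[OF that(1)] le_lead_monom[OF that(2)]
    by (cases "a = lead_monom p"; cases "b = lead_monom q") (auto simp: less_le)
  have "Poly_Mapping.lookup (p * q) (lead_monom p + lead_monom q) =
    (\<Sum>x\<in>Poly_Mapping.keys p \<times> Poly_Mapping.keys q. if x = (lead_monom p, lead_monom q)
      then Poly_Mapping.lookup p (lead_monom p) * Poly_Mapping.lookup q (lead_monom q) else 0)"
    unfolding lookup_mult_keys by (rule sum.cong) (auto simp: when_def eq split: if_splits)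
  thus ?thesis
    using assms by (simp add: lead_monom_in_keys)
qed

lemma lead_monom_mult:
  assumes "p \<noteq> 0" "q \<noteq> 0"
  shows "lead_monom (p * q) = lead_monom p + lead_monom q"
  unfolding lead_monom_def[of "p * q"]
proof (rule Max_eqI)
  show "lead_monom p + lead_monom q \<in> Poly_Mapping.keys (p * q)"
    using assms lead_monom_in_keys by (auto simp: in_keys_iff lookup_mult_lead_monom)
  show "m \<le> lead_monom p + lead_monom q" if m: "m \<in> Poly_Mapping.keys (p * q)" for m
  proof -
    obtain a b where "m = a + b" "a \<in> Poly_Mapping.keys p" "b \<in> Poly_Mapping.keys q"
      using m keys_mult[of p q] by blast
    thus ?thesis
      by (simp add: add_mono le_lead_monom)
  qed
qed simp

definition poly_size :: "int_mpoly \<Rightarrow> nat" where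
  "poly_size p = (\<Sum>i. Poly_Mapping.lookup (lead_monom p) i) +
    nat \<bar>Poly_Mapping.lookup p (lead_monom p)\<bar>"

lemma poly_mapping_nat_le_0: "m \<le> 0 \<Longrightarrow> m = 0" for m :: "nat \<Rightarrow>\<^sub>0 nat"
  by transfer (auto simp: less_fun_def)

lemma poly_size_less_mult:
  assumes "p \<noteq> 0" "q \<noteq> 0" and not_unit: "\<not> p dvd 1"
  shows "poly_size q < poly_size (p * q)"
proof -
  let ?deg = "\<lambda>p. \<Sum>i. Poly_Mapping.lookup (lead_monom p) i"
  let ?lc = "\<lambda>p. nat \<bar>Poly_Mapping.lookup p (lead_monom p)\<bar>"
  have deg: "?deg (p * q) = ?deg p + ?deg q"
    using assms by (simp add: lead_monom_mult lookup_add Sum_any.distrib)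
  have lc: "?lc (p * q) = ?lc p * ?lc q"
    using assms by (simp add: lead_monom_mult lookup_mult_lead_monom abs_mult nat_mult_distrib)
  have pos: "?lc p \<ge> 1" "?lc q \<ge> 1"
    using assms lead_monom_in_keys by (auto simp: in_keys_iff Suc_le_eq)
  have "?deg p > 0 \<or> ?lc p \<ge> 2"
  proof (rule ccontr)
    assume contr: "\<not> ?thesis"
    hence lm: "lead_monom p = 0"
      by (simp add: poly_mapping_eq_iff zero_poly_mapping.rep_eq)
    have "Poly_Mapping.keys p \<subseteq> {0}"
      using le_lead_monom[of _ p] poly_mapping_nat_le_0 unfolding lm by auto
    hence p: "p = Poly_Mapping.single 0 (Poly_Mapping.lookup p 0)"
      by (intro poly_mapping_eqI) (auto simp: lookup_single when_def in_keys_iff)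
    have "\<bar>Poly_Mapping.lookup p 0\<bar> = 1"
      using contr pos lm by auto
    hence "Poly_Mapping.lookup p 0 * Poly_Mapping.lookup p 0 = 1"
      by (metis abs_mult_self_eq mult_1)
    hence "p * p = 1"
      by (subst (1 2) p) (simp add: mult_single)
    thus False
      using not_unit by (metis dvd_triv_left)
  qed
  thus ?thesis
  proof
    assume "?deg p > 0"
    thus ?thesis
      unfolding poly_size_def deg lc using pos mult_le_mono1[OF pos(1), of "?lc q"] by linarith
  next
    assume "?lc p \<ge> 2"
    thus ?thesis
      unfolding poly_size_def deg lc using pos mult_le_mono1[of 2 "?lc p" "?lc q"] by linarith
  qed
qed

lemma coprime_representation:
  obtains P Q where "Q \<noteq> 0" "coprime_poly P Q" "f = Fract P Q"
proof -
  have "\<exists>P Q. Q \<noteq> 0 \<and> f = Fract P Q"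
    by (metis Fract_cases)
  then obtain Q where Q: "\<exists>P. Q \<noteq> 0 \<and> f = Fract P Q"
    and least: "\<And>R. \<exists>P. R \<noteq> 0 \<and> f = Fract P R \<Longrightarrow> poly_size Q \<le> poly_size R"
    using ex_has_least_nat[of "\<lambda>Q. \<exists>P. Q \<noteq> 0 \<and> f = Fract P Q" _ poly_size] by metis
  then obtain P where P: "Q \<noteq> 0" "f = Fract P Q"
    by blast
  have "c dvd 1" if c: "c dvd P" "c dvd Q" for c
  proof (rule ccontr)
    assume "\<not> c dvd 1"
    obtain P' Q' where P': "P = c * P'" and Q': "Q = c * Q'"
      using c by (elim dvdE)
    have "c \<noteq> 0" "Q' \<noteq> 0"
      using P(1) Q' by auto
    hence "poly_size Q' < poly_size Q"
      using \<open>\<not> c dvd 1\<close> unfolding Q' by (intro poly_size_less_mult)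
    moreover have "f = Fract P' Q'"
      using P(2) \<open>c \<noteq> 0\<close> unfolding P' Q' by (simp add: mult_fract_cancel)
    ultimately show False
      using least[of Q'] \<open>Q' \<noteq> 0\<close> by auto
  qed
  thus ?thesis
    using that P unfolding coprime_poly_def by blast
qed

section \<open>Sum-type and product-type expressions\<close>

interpretation commuting_derivations "\<lambda>i. fract_deriv (euler i)"
  by unfold_locales
    (simp_all add: derivation.add[OF derivation_fract_deriv] derivation.mult[OF derivation_fract_deriv]
      derivation_euler fract_deriv_commute euler_commute)

lemma supp_subset_Var: "supp f \<subseteq> Var f"
proof
  fix i assume i: "i \<in> supp f"
  obtain P Q where PQ: "Q \<noteq> 0" "coprime_poly P Q" "f = Fract P Q"
    by (rule coprime_representation)
  have "i \<in> poly_vars P \<union> poly_vars Q"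
  proof (rule ccontr)
    assume "i \<notin> poly_vars P \<union> poly_vars Q"
    hence "euler i P = 0" "euler i Q = 0"
      by (simp_all add: euler_eq_0)
    hence "fract_deriv (euler i) f = 0"
      using PQ by (simp add: fract_deriv_Fract derivation_euler Zero_fract_def eq_fract)
    thus False
      using i by (simp add: supp_def)
  qed
  thus "i \<in> Var f"
    using PQ by (auto simp: Var_def)
qed

lemma disjoint_supps_if_disjoint_Vars:
  assumes "disjoint_Vars fs"
  shows "disjoint_supps fs"
  unfolding sorted_wrt_iff_nth_less
proof (intro allI impI)
  fix i j assume "i < j" "j < length fs"
  hence "Var (fs ! i) \<inter> Var (fs ! j) = {}"
    using assms by (simp add: disjoint_Vars_def)
  thus "supp (fs ! i) \<inter> supp (fs ! j) = {}"
    using supp_subset_Var by blast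
qed

lemma disjoint_supps_map_inverse:
  "disjoint_supps (fs @ map inverse gs) \<longleftrightarrow> disjoint_supps (fs @ gs)"
  by (auto simp: sorted_wrt_append sorted_wrt_map)

lemma prod_list_divide: "prod_list fs / prod_list gs = prod_list (fs @ map inverse gs)"
  for fs gs :: "'a::field list"
  by (induction gs) (simp_all add: divide_inverse mult_ac)

lemma supp_X: "supp (X i) \<noteq> {}" "supp (- X i) \<noteq> {}"
proof -
  let ?x = "Poly_Mapping.single (Poly_Mapping.single i 1) 1 :: int_mpoly"
  have "euler i ?x = ?x"
    by (rule poly_mapping_eqI) (auto simp: lookup_euler lookup_single when_def)
  hence "fract_deriv (euler i) (X i) = X i"
    by (simp add: X_def fract_deriv_Fract derivation_euler derivation.one)
  moreover have "?x \<noteq> 0"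
    by (metis lookup_single_eq lookup_zero zero_neq_one)
  hence "X i \<noteq> 0"
    by (simp add: X_def Zero_fract_def eq_fract)
  ultimately have "i \<in> supp (X i)" "i \<in> supp (- X i)"
    by (simp_all add: supp_def derivation.uminus[OF derivation_fract_deriv] derivation_euler)
  thus "supp (X i) \<noteq> {}" "supp (- X i) \<noteq> {}"
    by blast+
qed

lemma supp_nonempty:
  shows "sum_type k f \<Longrightarrow> supp f \<noteq> {}" and "prod_type k f \<Longrightarrow> supp f \<noteq> {}"
proof (induction rule: sum_type_prod_type.inducts)
  case (sum_type_Suc fs k)
  hence "supp (sum_list fs) = \<Union>(supp ` set fs)"
    by (simp add: supp_sum_list disjoint_supps_if_disjoint_Vars)
  thus ?case
    using sum_type_Suc by blast
next
  case (prod_type_Suc fs gs k)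
  hence "disjoint_supps (fs @ map inverse gs)"
    by (simp add: disjoint_supps_map_inverse disjoint_supps_if_disjoint_Vars)
  moreover have "0 \<notin> set (fs @ map inverse gs)"
    using prod_type_Suc by auto
  ultimately have "supp (prod_list fs / prod_list gs) = \<Union>(supp ` set (fs @ map inverse gs))"
    unfolding prod_list_divide by (rule supp_prod_list)
  also have "\<dots> = \<Union>(supp ` set (fs @ gs))"
    by auto
  finally show ?case
    using prod_type_Suc by blast
qed (fact supp_X)+

theorem theorem3p1:
  shows "\<not> (\<exists>f :: int_ratfun. (\<exists>m > 0. sum_type m f) \<and> (\<exists>n > 0. prod_type n f))"
proof
  assume "\<exists>f. (\<exists>m > 0. sum_type m f) \<and> (\<exists>n > 0. prod_type n f)"
  then obtain f m n where "m > 0" "sum_type m f" and "n > 0" "prod_type n f"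
    by blast
  from \<open>sum_type m f\<close> \<open>m > 0\<close> obtain fs where
    fs: "f = sum_list fs" "length fs \<ge> 2" "disjoint_supps fs" "{} \<notin> supp ` set fs"
  proof cases
    case (sum_type_Suc fs k)
    have "{} \<notin> supp ` set fs"
      using sum_type_Suc(4) supp_nonempty(2) by fastforce
    thus ?thesis
      using that[of fs] sum_type_Suc disjoint_supps_if_disjoint_Vars by blast
  qed simp_all
  from \<open>prod_type n f\<close> \<open>n > 0\<close> obtain gs where
    gs: "f = prod_list gs" "length gs \<ge> 2" "disjoint_supps gs" "{} \<notin> supp ` set gs"
  proof cases
    case (prod_type_Suc gs hs k)
    have "{} \<notin> supp ` set (gs @ map inverse hs)"
    proof -
      have "supp g \<noteq> {}" if "g \<in> set (gs @ hs)" for g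
        using prod_type_Suc that supp_nonempty(1) by blast
      thus ?thesis
        by fastforce
    qed
    moreover have "disjoint_supps (gs @ map inverse hs)"
      using prod_type_Suc by (simp add: disjoint_supps_map_inverse disjoint_supps_if_disjoint_Vars)
    ultimately show ?thesis
      using that[of "gs @ map inverse hs"] prod_type_Suc by (simp add: prod_list_divide)
  qed simp_all
  show False
    using sum_list_ne_prod_list[OF fs(2-4) gs(2-4)] fs(1) gs(1) by simp
qed

end
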